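(* Let $\rho_1\in\mathbb{R}$ and let $\mathbb{G}(\rho_1)$ be a three-dimensional Lie group whose Lie algebra (identified with the left-invariant vector fields) has a basis $\{X,Y,Z\}$ satisfying $$[X,Y]=Z,\qquad [X,Z]=-\rho_1 Y,\qquad [Y,Z]=\rho_1 X .$$ Let $L=X^2+Y^2$ and $\Gamma^Z(f,g)=(Zf)(Zg)$. Then $L$ satisfies the generalized curvature-dimension inequality $\mathrm{CD}(\rho_1,\tfrac12,1,2)$ with respect to $\Gamma^Z$; that is, for every $f\in C^\infty(\mathbb{G}(\rho_1))$ and every $\nu>0$, $$\Gamma_2(f)+\nu\,\Gamma_2^Z(f)\ \ge\ \frac12 (Lf)^2+\Big(\rho_1-\frac1\nu\Big)\Gamma(f)+\frac12\,\Gamma^Z(f).$$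
   Context: For smooth functions $f,g$: $\Gamma(f,g)=\frac12\big(L(fg)-fLg-gLf\big)=(Xf)(Xg)+(Yf)(Yg)$, $\Gamma(f)=\Gamma(f,f)$, $\Gamma^Z(f)=\Gamma^Z(f,f)$, $$\Gamma_2(f)=\tfrac12\big[L\Gamma(f)-2\Gamma(f,Lf)\big],\qquad \Gamma_2^Z(f)=\tfrac12\big[L\Gamma^Z(f)-2\Gamma^Z(f,Lf)\big].$$ In general, $\mathrm{CD}(\rho_1,\rho_2,\kappa,d)$ with respect to $L$ and $\Gamma^Z$ (with $\rho_1\in\mathbb{R}$, $\rho_2>0$, $\kappa\ge0$, $0<d\le\infty$) means that $\Gamma_2(f)+\nu\Gamma_2^Z(f)\ge \frac1d(Lf)^2+(\rho_1-\frac{\kappa}{\nu})\Gamma(f)+\rho_2\Gamma^Z(f)$ for all smooth $f$ and all $\nu>0$. *)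

theory Defs
  imports "HOL-Analysis.Analysis"
begin

section \<open>Smooth functions on open sets\<close>

text \<open>
  \<open>Ck_on k S f\<close> is meant for open \<open>S\<close> in a Euclidean space. All directional derivatives of a
  differentiable function being of class \<open>C^k\<close> says exactly that its Frechet derivative is.
\<close>

primrec Ck_on :: "nat \<Rightarrow> 'a::euclidean_space set \<Rightarrow> ('a \<Rightarrow> 'b::real_normed_vector) \<Rightarrow> bool" where
  "Ck_on 0 S f \<longleftrightarrow> continuous_on S f"
| "Ck_on (Suc k) S f \<longleftrightarrow>
     (\<forall>x\<in>S. f differentiable (at x)) \<and>
     (\<forall>v. Ck_on k S (\<lambda>x. frechet_derivative f (at x) v))"

definition smooth_on :: "'a::euclidean_space set \<Rightarrow> ('a \<Rightarrow> 'b::real_normed_vector) \<Rightarrow> bool" where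
  "smooth_on S f \<longleftrightarrow> (\<forall>k. Ck_on k S f)"


section \<open>Smooth manifolds\<close>

text \<open>
  The points of a manifold are all elements of a topological type. A chart is a pair \<open>(U, \<phi>)\<close>; the
  values of \<open>\<phi>\<close> outside \<open>U\<close> are irrelevant, and the inverse chart is \<open>inv_into U \<phi>\<close>. The dimension
  is that of the model space \<open>'e\<close>. Atlases are not assumed maximal: an atlas and the maximal atlas
  containing it have the same smooth maps.
\<close>

type_synonym ('m, 'e) chart = "'m set \<times> ('m \<Rightarrow> 'e)"

definition is_chart :: "('m::topological_space, 'e::euclidean_space) chart \<Rightarrow> bool" where
  "is_chart = (\<lambda>(U, \<phi>). open U \<and> open (\<phi> ` U) \<and> homeomorphism U (\<phi> ` U) \<phi> (inv_into U \<phi>))"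

locale smooth_manifold =
  fixes A :: "('m::{t2_space, second_countable_topology}, 'e::euclidean_space) chart set"
  assumes charts: "c \<in> A \<Longrightarrow> is_chart c"
    and cover: "(\<Union>c\<in>A. fst c) = UNIV"
    and transition: "(U, \<phi>) \<in> A \<Longrightarrow> (V, \<psi>) \<in> A \<Longrightarrow>
      smooth_on (\<phi> ` (U \<inter> V)) (\<psi> \<circ> inv_into U \<phi>)"

definition smooth_map ::
    "('m::topological_space, 'e::euclidean_space) chart set \<Rightarrow>
     ('n::topological_space, 'd::euclidean_space) chart set \<Rightarrow> ('m \<Rightarrow> 'n) \<Rightarrow> bool" where
  "smooth_map A B F \<longleftrightarrow> continuous_on UNIV F \<and>
     (\<forall>(U, \<phi>)\<in>A. \<forall>(V, \<psi>)\<in>B. smooth_on (\<phi> ` (U \<inter> F -` V)) (\<psi> \<circ> F \<circ> inv_into U \<phi>))"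

definition prod_atlas ::
    "('m, 'e) chart set \<Rightarrow> ('n, 'd) chart set \<Rightarrow> ('m \<times> 'n, 'e \<times> 'd) chart set" where
  "prod_atlas A B = {(U \<times> V, map_prod \<phi> \<psi>) | U \<phi> V \<psi>. (U, \<phi>) \<in> A \<and> (V, \<psi>) \<in> B}"

definition C_infinity :: "('m::topological_space, 'e::euclidean_space) chart set \<Rightarrow> ('m \<Rightarrow> real) set" where
  "C_infinity A = {f. \<forall>(U, \<phi>)\<in>A. smooth_on (\<phi> ` U) (f \<circ> inv_into U \<phi>)}"


section \<open>Vector fields\<close>

text \<open>
  Tangent vectors at \<open>p\<close> are the derivations at \<open>p\<close> of the algebra of smooth functions. HOL functions
  being total, a derivation also has values at non-smooth functions; fixing those to be \<open>0\<close> makes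
  equality of derivations the same as equality on smooth functions.
\<close>

definition tangent_vector ::
    "('m::topological_space, 'e::euclidean_space) chart set \<Rightarrow> 'm \<Rightarrow> (('m \<Rightarrow> real) \<Rightarrow> real) \<Rightarrow> bool" where
  "tangent_vector A p v \<longleftrightarrow>
     (\<forall>f\<in>C_infinity A. \<forall>g\<in>C_infinity A. v (\<lambda>x. f x + g x) = v f + v g) \<and>
     (\<forall>f\<in>C_infinity A. \<forall>c. v (\<lambda>x. c * f x) = c * v f) \<and>
     (\<forall>f\<in>C_infinity A. \<forall>g\<in>C_infinity A. v (\<lambda>x. f x * g x) = f p * v g + g p * v f) \<and>
     (\<forall>f. f \<notin> C_infinity A \<longrightarrow> v f = 0)"

text \<open>
  An operator \<open>X\<close> sends \<open>f\<close> to \<open>X f\<close>; as a vector field, its value at \<open>p\<close> is the tangent vector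
  \<open>\<lambda>f. X f p\<close>, and smoothness of the field means that it maps smooth functions to smooth functions.
\<close>

type_synonym 'm operator = "('m \<Rightarrow> real) \<Rightarrow> ('m \<Rightarrow> real)"

definition vector_field ::
    "('m::topological_space, 'e::euclidean_space) chart set \<Rightarrow> 'm operator \<Rightarrow> bool" where
  "vector_field A X \<longleftrightarrow>
     (\<forall>p. tangent_vector A p (\<lambda>f. X f p)) \<and> (\<forall>f\<in>C_infinity A. X f \<in> C_infinity A)"

definition lie_bracket :: "'m operator \<Rightarrow> 'm operator \<Rightarrow> 'm operator" where
  "lie_bracket X Y = (\<lambda>f x. X (Y f) x - Y (X f) x)"


section \<open>Lie groups\<close>

locale lie_group = smooth_manifold A + group mul e ivs
  for A :: "('g::{t2_space, second_countable_topology}, 'e::euclidean_space) chart set"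
    and mul :: "'g \<Rightarrow> 'g \<Rightarrow> 'g" and e :: 'g and ivs :: "'g \<Rightarrow> 'g" +
  assumes smooth_mult: "smooth_map (prod_atlas A A) A (\<lambda>(x, y). mul x y)"
    and smooth_inv: "smooth_map A A ivs"

text \<open>
  Left invariance \<open>dL\<^sub>a (X\<^sub>x) = X\<^sub>a\<^sub>x\<close>, applied to a function \<open>f\<close>, reads \<open>X (f \<circ> L\<^sub>a) x = (X f) (a x)\<close>.
\<close>

definition lie_algebra ::
    "('g::topological_space, 'e::euclidean_space) chart set \<Rightarrow> ('g \<Rightarrow> 'g \<Rightarrow> 'g) \<Rightarrow> 'g operator set" where
  "lie_algebra A mul = {X. vector_field A X \<and>
     (\<forall>a. \<forall>f\<in>C_infinity A. X (\<lambda>x. f (mul a x)) = (\<lambda>x. X f (mul a x)))}"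

definition lie_algebra_basis ::
    "('g::topological_space, 'e::euclidean_space) chart set \<Rightarrow> ('g \<Rightarrow> 'g \<Rightarrow> 'g) \<Rightarrow>
     'g operator \<Rightarrow> 'g operator \<Rightarrow> 'g operator \<Rightarrow> bool" where
  "lie_algebra_basis A mul X Y Z \<longleftrightarrow>
     X \<in> lie_algebra A mul \<and> Y \<in> lie_algebra A mul \<and> Z \<in> lie_algebra A mul \<and>
     (\<forall>a b c. (\<forall>f x. a * X f x + b * Y f x + c * Z f x = 0) \<longrightarrow> a = 0 \<and> b = 0 \<and> c = 0) \<and>
     (\<forall>W\<in>lie_algebra A mul. \<exists>a b c. W = (\<lambda>f x. a * X f x + b * Y f x + c * Z f x))"


section \<open>Generalized curvature-dimension inequalities\<close>

definition sub_laplacian :: "'m operator \<Rightarrow> 'm operator \<Rightarrow> 'm operator" where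
  "sub_laplacian X Y = (\<lambda>f x. X (X f) x + Y (Y f) x)"

definition Gamma_form :: "'m operator \<Rightarrow> ('m \<Rightarrow> real) \<Rightarrow> ('m \<Rightarrow> real) \<Rightarrow> ('m \<Rightarrow> real)" where
  "Gamma_form L f g = (\<lambda>x. (1/2) * (L (\<lambda>y. f y * g y) x - f x * L g x - g x * L f x))"

definition GammaZ :: "'m operator \<Rightarrow> ('m \<Rightarrow> real) \<Rightarrow> ('m \<Rightarrow> real) \<Rightarrow> ('m \<Rightarrow> real)" where
  "GammaZ Z f g = (\<lambda>x. Z f x * Z g x)"

text \<open>
  Iteration of a bilinear form \<open>B\<close> along \<open>L\<close>: \<open>\<Gamma>\<^sub>2\<close> is \<open>iter_Gamma L (Gamma_form L)\<close> and \<open>\<Gamma>\<^sub>2\<^sup>Z\<close> is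
  \<open>iter_Gamma L (GammaZ Z)\<close>.
\<close>

definition iter_Gamma ::
    "'m operator \<Rightarrow> (('m \<Rightarrow> real) \<Rightarrow> ('m \<Rightarrow> real) \<Rightarrow> ('m \<Rightarrow> real)) \<Rightarrow> 'm operator" where
  "iter_Gamma L B f = (\<lambda>x. (1/2) * (L (B f f) x - 2 * B f (L f) x))"

text \<open>
  The dimension \<open>d\<close> ranges over \<open>(0, \<infinity>]\<close>; in the extended reals \<open>1 / \<infinity> = 0\<close>.
\<close>

definition CD ::
    "('m::topological_space, 'e::euclidean_space) chart set \<Rightarrow> 'm operator \<Rightarrow>
     (('m \<Rightarrow> real) \<Rightarrow> ('m \<Rightarrow> real) \<Rightarrow> ('m \<Rightarrow> real)) \<Rightarrow> real \<Rightarrow> real \<Rightarrow> real \<Rightarrow> ereal \<Rightarrow> bool" where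
  "CD A L GZ \<rho>\<^sub>1 \<rho>\<^sub>2 \<kappa> d \<longleftrightarrow> \<rho>\<^sub>2 > 0 \<and> \<kappa> \<ge> 0 \<and> d > 0 \<and>
     (\<forall>f\<in>C_infinity A. \<forall>\<nu>>0. \<forall>x.
        iter_Gamma L (Gamma_form L) f x + \<nu> * iter_Gamma L GZ f x
          \<ge> real_of_ereal (1 / d) * (L f x)\<^sup>2 + (\<rho>\<^sub>1 - \<kappa> / \<nu>) * Gamma_form L f f x + \<rho>\<^sub>2 * GZ f f x)"

end

(* X, Y and Z act on smooth functions as derivations, so both iterated forms can be expanded. Since
   [L, X] = -YZ - ZY, [L, Y] = XZ + ZX and [L, Z] = 0, one finds

     Gamma_2(f) = (XXf)^2 + (XYf)^2 + (YXf)^2 + (YYf)^2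
                  + rho_1 Gamma(f) - 2 (Xf)(YZf) + 2 (Yf)(XZf),
     Gamma_2^Z(f) = (XZf)^2 + (YZf)^2.

   Now (XXf)^2 + (YYf)^2 >= (Lf)^2 / 2, and (XYf)^2 + (YXf)^2 >= (Zf)^2 / 2 since XYf - YXf = Zf.
   The two mixed terms are absorbed by nu Gamma_2^Z(f) + Gamma(f) / nu. *)
theory Submission
  imports Defs
begin

text \<open>Openness turns agreement on \<open>S\<close> into agreement near each of its points, so
  the derivatives agree on \<open>S\<close> as well. This lets derivative formulas valid only on
  \<open>S\<close> be used inside \<open>Ck_on\<close>.\<close>

lemma Ck_on_cong:
  assumes "open S" "\<And>x. x \<in> S \<Longrightarrow> f x = g x" "Ck_on k S f"
  shows "Ck_on k S g"
  using assms(2,3)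
proof (induction k arbitrary: f g)
  case 0
  then show ?case by (simp cong: continuous_on_cong)
next
  case (Suc k)
  have hd: "(g has_derivative frechet_derivative f (at x)) (at x)" if "x \<in> S" for x
    using has_derivative_transform_within_open[OF _ assms(1) that] Suc.prems that
    by (metis Ck_on.simps(2) frechet_derivative_works)
  then have eq: "frechet_derivative g (at x) = frechet_derivative f (at x)" if "x \<in> S" for x
    using that frechet_derivative_at by metis
  have "Ck_on k S (\<lambda>x. frechet_derivative g (at x) v)" for v
    using Suc.IH[of "\<lambda>x. frechet_derivative f (at x) v" "\<lambda>x. frechet_derivative g (at x) v"]
      eq Suc.prems(2) by simp
  then show ?case
    using hd by (auto simp: differentiable_def)
qed

lemma Ck_on_Suc_imp: "Ck_on (Suc k) S f \<Longrightarrow> Ck_on k S f"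
proof (induction k arbitrary: f)
  case 0
  then show ?case
    by (auto intro!: continuous_at_imp_continuous_on differentiable_imp_continuous_within)
next
  case (Suc k)
  then show ?case by (metis Ck_on.simps(2))
qed

lemma Ck_on_add:
  assumes "open S" "Ck_on k S f" "Ck_on k S g"
  shows "Ck_on k S (\<lambda>x. f x + g x)"
  using assms(2,3)
proof (induction k arbitrary: f g)
  case 0
  then show ?case by (simp add: continuous_on_add)
next
  case (Suc k)
  have hd: "((\<lambda>x. f x + g x) has_derivative
      (\<lambda>v. frechet_derivative f (at x) v + frechet_derivative g (at x) v)) (at x)" if "x \<in> S" for x
    using Suc.prems that by (auto intro!: has_derivative_add simp: frechet_derivative_works[symmetric])
  have "Ck_on k S (\<lambda>x. frechet_derivative (\<lambda>x. f x + g x) (at x) v)" for v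
  proof (rule Ck_on_cong[OF assms(1)])
    show "Ck_on k S (\<lambda>x. frechet_derivative f (at x) v + frechet_derivative g (at x) v)"
      using Suc by simp
    show "frechet_derivative f (at x) v + frechet_derivative g (at x) v =
        frechet_derivative (\<lambda>x. f x + g x) (at x) v" if "x \<in> S" for x
      using frechet_derivative_at[OF hd[OF that]] by metis
  qed
  then show ?case
    using hd by (auto simp: differentiable_def)
qed

lemma Ck_on_mult:
  fixes f g :: "'a::euclidean_space \<Rightarrow> 'b::real_normed_algebra"
  assumes "open S" "Ck_on k S f" "Ck_on k S g"
  shows "Ck_on k S (\<lambda>x. f x * g x)"
  using assms(2,3)
proof (induction k arbitrary: f g)
  case 0
  then show ?case by (simp add: continuous_on_mult)
next
  case (Suc k)
  have hd: "((\<lambda>x. f x * g x) has_derivative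
      (\<lambda>v. f x * frechet_derivative g (at x) v + frechet_derivative f (at x) v * g x)) (at x)"
    if "x \<in> S" for x
    using Suc.prems that by (auto intro!: has_derivative_mult simp: frechet_derivative_works[symmetric])
  have "Ck_on k S (\<lambda>x. frechet_derivative (\<lambda>x. f x * g x) (at x) v)" for v
  proof (rule Ck_on_cong[OF assms(1)])
    \<comment> \<open>The Leibniz formula contains \<open>f\<close> and \<open>g\<close> themselves
      beside their derivatives, so one order of regularity is given up for them.\<close>
    have "Ck_on k S f" "Ck_on k S g"
      using Suc.prems by (blast intro: Ck_on_Suc_imp)+
    then show "Ck_on k S (\<lambda>x. f x * frechet_derivative g (at x) v + frechet_derivative f (at x) v * g x)"
      using Suc by (intro Ck_on_add[OF assms(1)]) auto
    show "f x * frechet_derivative g (at x) v + frechet_derivative f (at x) v * g x =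
        frechet_derivative (\<lambda>x. f x * g x) (at x) v" if "x \<in> S" for x
      using frechet_derivative_at[OF hd[OF that]] by metis
  qed
  then show ?case
    using hd by (auto simp: differentiable_def)
qed

lemma Ck_on_const: "Ck_on k S (\<lambda>x. c)"
  by (induction k arbitrary: c) auto

context smooth_manifold
begin

lemma open_chart_image: "(U, \<phi>) \<in> A \<Longrightarrow> open (\<phi> ` U)"
  using charts by (force simp: is_chart_def)

text \<open>The derivation laws apply to smooth arguments only, so functions such as \<Gamma>(f)
  have to be known smooth before a field acts on them.\<close>

lemma C_infinity_add:
  assumes "f \<in> C_infinity A" "g \<in> C_infinity A"
  shows "(\<lambda>x. f x + g x) \<in> C_infinity A"
  using assms Ck_on_add[OF open_chart_image]
  by (fastforce simp: C_infinity_def smooth_on_def o_def)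

lemma C_infinity_mult:
  assumes "f \<in> C_infinity A" "g \<in> C_infinity A"
  shows "(\<lambda>x. f x * g x) \<in> C_infinity A"
  using assms Ck_on_mult[OF open_chart_image]
  by (fastforce simp: C_infinity_def smooth_on_def o_def)

lemma C_infinity_scale: "f \<in> C_infinity A \<Longrightarrow> (\<lambda>x. c * f x) \<in> C_infinity A"
  by (rule C_infinity_mult) (auto simp: C_infinity_def smooth_on_def o_def Ck_on_const)

end

context
  fixes A :: "('m::topological_space, 'e::euclidean_space) chart set" and X :: "'m operator"
  assumes X: "vector_field A X"
begin

lemma vector_field_C_infinity: "f \<in> C_infinity A \<Longrightarrow> X f \<in> C_infinity A"
  using X by (simp add: vector_field_def)

text \<open>The pointwise laws at all \<open>p\<close> combine into an equation between functions,
  which can rewrite under a further operator.\<close>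

lemma vector_field_add:
  "f \<in> C_infinity A \<Longrightarrow> g \<in> C_infinity A \<Longrightarrow> X (\<lambda>x. f x + g x) = (\<lambda>x. X f x + X g x)"
  using X by (auto simp: vector_field_def tangent_vector_def)

lemma vector_field_scale: "f \<in> C_infinity A \<Longrightarrow> X (\<lambda>x. c * f x) = (\<lambda>x. c * X f x)"
  using X by (auto simp: vector_field_def tangent_vector_def)

lemma vector_field_mult:
  "f \<in> C_infinity A \<Longrightarrow> g \<in> C_infinity A \<Longrightarrow> X (\<lambda>x. f x * g x) = (\<lambda>x. f x * X g x + g x * X f x)"
  using X by (auto simp: vector_field_def tangent_vector_def)

end

context smooth_manifold
begin

context
  fixes X Y :: "'m operator"
  assumes X: "vector_field A X" and Y: "vector_field A Y"
begin

lemma sub_laplacian_C_infinity: "f \<in> C_infinity A \<Longrightarrow> sub_laplacian X Y f \<in> C_infinity A"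
  unfolding sub_laplacian_def
  by (intro C_infinity_add vector_field_C_infinity[OF X] vector_field_C_infinity[OF Y])

lemma sub_laplacian_add:
  "f \<in> C_infinity A \<Longrightarrow> g \<in> C_infinity A \<Longrightarrow>
    sub_laplacian X Y (\<lambda>x. f x + g x) = (\<lambda>x. sub_laplacian X Y f x + sub_laplacian X Y g x)"
  by (simp add: sub_laplacian_def vector_field_add[OF X] vector_field_add[OF Y]
      vector_field_C_infinity[OF X] vector_field_C_infinity[OF Y] algebra_simps)

text \<open>Leibniz applied twice: each of \<open>X\<close> and \<open>Y\<close> produces its cross
  term two times, whence the factor 2.\<close>

lemma sub_laplacian_mult:
  "f \<in> C_infinity A \<Longrightarrow> g \<in> C_infinity A \<Longrightarrow> sub_laplacian X Y (\<lambda>x. f x * g x) =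
    (\<lambda>x. f x * sub_laplacian X Y g x + g x * sub_laplacian X Y f x + 2 * (X f x * X g x + Y f x * Y g x))"
  by (simp add: sub_laplacian_def vector_field_mult[OF X] vector_field_mult[OF Y]
      vector_field_add[OF X] vector_field_add[OF Y] C_infinity_mult
      vector_field_C_infinity[OF X] vector_field_C_infinity[OF Y] algebra_simps)

lemma Gamma_form_sub_laplacian:
  "f \<in> C_infinity A \<Longrightarrow> g \<in> C_infinity A \<Longrightarrow>
    Gamma_form (sub_laplacian X Y) f g = (\<lambda>x. X f x * X g x + Y f x * Y g x)"
  by (simp add: Gamma_form_def sub_laplacian_mult add_divide_distrib)

text \<open>By the product rule, half of L((Zf)^2) is Zf L(Zf) + (XZf)^2 + (YZf)^2; subtracting Zf
  Z(Lf) leaves the commutator. \<open>Z\<close> is an arbitrary vector field here.\<close>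

lemma iter_Gamma_GammaZ:
  assumes Z: "vector_field A Z" and f: "f \<in> C_infinity A"
  shows "iter_Gamma (sub_laplacian X Y) (GammaZ Z) f x =
    (X (Z f) x)\<^sup>2 + (Y (Z f) x)\<^sup>2 + Z f x * lie_bracket (sub_laplacian X Y) Z f x"
  using f by (simp add: iter_Gamma_def GammaZ_def lie_bracket_def sub_laplacian_mult
      vector_field_C_infinity[OF Z] power2_eq_square algebra_simps)

text \<open>A Bochner formula: the same computation for (Xf)^2 and (Yf)^2, summed. The curvature is
  still hidden in the two commutators with L.\<close>

lemma iter_Gamma_Gamma_form:
  assumes f: "f \<in> C_infinity A"
  shows "iter_Gamma (sub_laplacian X Y) (Gamma_form (sub_laplacian X Y)) f x =
    (X (X f) x)\<^sup>2 + (X (Y f) x)\<^sup>2 + (Y (X f) x)\<^sup>2 + (Y (Y f) x)\<^sup>2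
    + X f x * lie_bracket (sub_laplacian X Y) X f x + Y f x * lie_bracket (sub_laplacian X Y) Y f x"
  using f by (simp add: iter_Gamma_def Gamma_form_sub_laplacian lie_bracket_def sub_laplacian_mult
      sub_laplacian_add sub_laplacian_C_infinity C_infinity_mult
      vector_field_C_infinity[OF X] vector_field_C_infinity[OF Y] power2_eq_square algebra_simps)

end

end

text \<open>The variables stand for values at one point: \<open>x\<close> for Xf, \<open>xy\<close>
  for XYf, \<open>yz\<close> for YZf, and so on. The left side is the Bochner expansion with the
  commutators already evaluated.\<close>

lemma CD_pointwise_ineq:
  fixes \<nu> :: real
  assumes \<nu>: "\<nu> > 0" and z: "xy - yx = z"
  shows "xx\<^sup>2 + xy\<^sup>2 + yx\<^sup>2 + yy\<^sup>2 + x * (\<rho> * x - 2 * yz) + y * (\<rho> * y + 2 * xz) + \<nu> * (xz\<^sup>2 + yz\<^sup>2)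
    \<ge> 1/2 * (xx + yy)\<^sup>2 + (\<rho> - 1 / \<nu>) * (x * x + y * y) + 1/2 * (z * z)"
proof -
  have "1/2 * (xx + yy)\<^sup>2 \<le> xx\<^sup>2 + yy\<^sup>2"
    using sum_squares_bound[of xx yy] by (simp add: power2_sum)
  \<comment> \<open>The difference of the two sides is (xy + yx)^2 / 2.\<close>
  moreover have "1/2 * (z * z) \<le> xy\<^sup>2 + yx\<^sup>2"
    using zero_le_power2[of "xy + yx"] unfolding z[symmetric]
    by (simp add: power2_eq_square algebra_simps)
  \<comment> \<open>Completing the square in \<open>yz\<close> and in \<open>xz\<close> costs
    exactly (x^2 + y^2) / \<nu>, which is where \<kappa> = 1 comes from.\<close>
  moreover have "\<nu> * (yz - x / \<nu>)\<^sup>2 = \<nu> * yz\<^sup>2 - 2 * x * yz + x * x / \<nu>"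
    "\<nu> * (xz + y / \<nu>)\<^sup>2 = \<nu> * xz\<^sup>2 + 2 * y * xz + y * y / \<nu>"
    using \<nu> by (simp_all add: power2_eq_square field_simps)
  moreover have "\<nu> * (yz - x / \<nu>)\<^sup>2 \<ge> 0" "\<nu> * (xz + y / \<nu>)\<^sup>2 \<ge> 0"
    using \<nu> by simp_all
  ultimately show ?thesis
    by (simp add: algebra_simps power2_eq_square add_divide_distrib)
qed

theorem proposition1p5:
  fixes \<rho>\<^sub>1 :: real
    and A :: "('g::{t2_space, second_countable_topology}, real ^ 3) chart set"
    and mul :: "'g \<Rightarrow> 'g \<Rightarrow> 'g" and e :: 'g and ivs :: "'g \<Rightarrow> 'g"
    and X Y Z :: "'g operator"
  assumes "lie_group A mul e ivs"
    and "lie_algebra_basis A mul X Y Z"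
    and "lie_bracket X Y = Z"
    and "lie_bracket X Z = (\<lambda>f x. - \<rho>\<^sub>1 * Y f x)"
    and "lie_bracket Y Z = (\<lambda>f x. \<rho>\<^sub>1 * X f x)"
  shows "let L = sub_laplacian X Y in
    CD A L (GammaZ Z) \<rho>\<^sub>1 (1/2) 1 2 \<and>
    (\<forall>f\<in>C_infinity A. \<forall>\<nu>>0. \<forall>x.
      iter_Gamma L (Gamma_form L) f x + \<nu> * iter_Gamma L (GammaZ Z) f x
        \<ge> (1/2) * (L f x)\<^sup>2 + (\<rho>\<^sub>1 - 1 / \<nu>) * Gamma_form L f f x + (1/2) * GammaZ Z f f x)"
proof -
  let ?L = "sub_laplacian X Y"
  interpret lie_group A mul e ivs by fact
  have X: "vector_field A X" and Y: "vector_field A Y" and Z: "vector_field A Z"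
    using assms(2) by (auto simp: lie_algebra_basis_def lie_algebra_def)
  note mem = vector_field_C_infinity[OF X] vector_field_C_infinity[OF Y] vector_field_C_infinity[OF Z]
  note add = vector_field_add[OF X] vector_field_add[OF Y] vector_field_add[OF Z]
  have XY: "X (Y f) = (\<lambda>x. Y (X f) x + Z f x)" for f
    using fun_cong[OF fun_cong[OF assms(3)], of f]
    by (simp add: lie_bracket_def fun_eq_iff diff_eq_eq add.commute)
  \<comment> \<open>The sum with coefficient \<open>- \<rho>\<^sub>1\<close>, instead of a
    difference, fits the additivity and scaling rules.\<close>
  have XZ: "X (Z f) = (\<lambda>x. Z (X f) x + - \<rho>\<^sub>1 * Y f x)" for f
    using fun_cong[OF fun_cong[OF assms(4)], of f]
    by (simp add: lie_bracket_def fun_eq_iff diff_eq_eq add.commute)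
  have YZ: "Y (Z f) = (\<lambda>x. Z (Y f) x + \<rho>\<^sub>1 * X f x)" for f
    using fun_cong[OF fun_cong[OF assms(5)], of f]
    by (simp add: lie_bracket_def fun_eq_iff diff_eq_eq add.commute)
  have ineq: "iter_Gamma ?L (Gamma_form ?L) f x + \<nu> * iter_Gamma ?L (GammaZ Z) f x
      \<ge> (1/2) * (?L f x)\<^sup>2 + (\<rho>\<^sub>1 - 1 / \<nu>) * Gamma_form ?L f f x + (1/2) * GammaZ Z f f x"
    if f: "f \<in> C_infinity A" and \<nu>: "\<nu> > 0" for f \<nu> x
  proof -
    have YXY: "Y (X (Y f)) x = Y (Y (X f)) x + Y (Z f) x"
      unfolding XY[of f] using f by (simp add: add mem)
    have XXY: "X (X (Y f)) x = X (Y (X f)) x + X (Z f) x"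
      unfolding XY[of f] using f by (simp add: add mem)
    \<comment> \<open>The cubes of \<open>X\<close> cancel, leaving YYX - XYY = -YZ - ZY; then ZY =
      YZ - \<rho>X, with \<rho> for \<open>\<rho>\<^sub>1\<close>, orders both terms alike.\<close>
    have LX: "lie_bracket ?L X f x = \<rho>\<^sub>1 * X f x - 2 * Y (Z f) x"
      using f YXY fun_cong[OF XY, of "Y f" x] fun_cong[OF YZ, of f x]
      by (simp add: lie_bracket_def sub_laplacian_def add mem)
    \<comment> \<open>Here XXY - YXX = XZ + ZX, and ZX = XZ + \<rho>Y.\<close>
    have LY: "lie_bracket ?L Y f x = \<rho>\<^sub>1 * Y f x + 2 * X (Z f) x"
      using f XXY fun_cong[OF XY, of "X f" x] fun_cong[OF XZ, of f x]
      by (simp add: lie_bracket_def sub_laplacian_def add mem)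
    have XXZ: "X (X (Z f)) x = X (Z (X f)) x + - \<rho>\<^sub>1 * X (Y f) x"
      unfolding XZ[of f] using f by (simp only: add mem C_infinity_scale vector_field_scale[OF X])
    have YYZ: "Y (Y (Z f)) x = Y (Z (Y f)) x + \<rho>\<^sub>1 * Y (X f) x"
      unfolding YZ[of f] using f by (simp add: add mem C_infinity_scale vector_field_scale[OF Y])
    \<comment> \<open>XXZ - ZXX = -\<rho>(XY + YX) and YYZ - ZYY = \<rho>(XY + YX) cancel, so L
      commutes with \<open>Z\<close>.\<close>
    have LZ: "lie_bracket ?L Z f x = 0"
      using f XXZ YYZ fun_cong[OF XZ, of "X f" x] fun_cong[OF YZ, of "Y f" x]
      by (simp add: lie_bracket_def sub_laplacian_def add mem)
    have z: "X (Y f) x - Y (X f) x = Z f x"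
      using fun_cong[OF XY, of f x] by simp
    show ?thesis
      using CD_pointwise_ineq[OF \<nu> z, where xx = "X (X f) x" and yy = "Y (Y f) x" and x = "X f x"
          and y = "Y f x" and xz = "X (Z f) x" and yz = "Y (Z f) x" and \<rho> = \<rho>\<^sub>1] f
      by (simp add: iter_Gamma_GammaZ[OF X Y Z] iter_Gamma_Gamma_form[OF X Y] LX LY LZ
          Gamma_form_sub_laplacian[OF X Y]) (simp add: GammaZ_def sub_laplacian_def)
  qed
  \<comment> \<open>The dimension in \<open>CD\<close> is an extended real, so its coefficient must
    be converted before both conjuncts become \<open>ineq\<close>.\<close>
  have half: "real_of_ereal (1 / 2) = 1 / 2"
    by (simp add: one_ereal_def)
  show ?thesis
    unfolding CD_def Let_def half using ineq by simp
qed

end
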